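(* Let $M\in\mathbb{R}^{(n+1)\times(n+1)}$ be a singular $F_0$-matrix, given by $$M=\begin{pmatrix} A & b\\ c^T & 0\end{pmatrix},$$ where $A\in\mathbb{R}^{n\times n}$ is an $N_0$-matrix and $b,c\in\mathbb{R}^n$ are (entrywise) nonpositive vectors. Then: (1) $M$ is an $R_0$-matrix if and only if $b\neq 0$. (2) $M$ is not a semimonotone matrix. (3) If $-M$ is a $Q_0$-matrix, then $c=0$.
   Context: Inequalities between matrices or vectors are entrywise. A real square matrix is a $Z$-matrix if all its off-diagonal entries are nonpositive; any $Z$-matrix can be written as $A=sI-B$ with $s\in\mathbb{R}$ and $B\ge 0$. Let $\rho$ denote the spectral radius, and for $B\in\mathbb{R}^{m\times m}$ let $\rho_{m-1}(B)$ be the maximum of the spectral radii of the principal submatrices of $B$ of order $m-1$. A $Z$-matrix $A=sI-B$ ($B\ge0$) of order $m$ is an $M$-matrix if $s\ge\rho(B)$, and an $N_0$-matrix if $\rho_{m-1}(B)\le s<\rho(B)$. A $Z$-matrix of order $m\ge 3$ is an $F_0$-matrix if all its principal submatrices of orders at most $m-2$ are $M$-matrices and at least one principal submatrix of order $m-1$ is an $N_0$-matrix. (Every singular $F_0$-matrix of order $n+1$ can be brought to the displayed form by a simultaneous permutation of rows and columns.) For $K\in\mathbb{R}^{m\times m}$ and $q\in\mathbb{R}^m$, the linear complementarity problem LCP$(K,q)$ is to find $x\in\mathbb{R}^m$ with $x\ge0$, $y:=Kx+q\ge0$ and $x^Ty=0$. A vector $x$ satisfying the first two conditions is feasible; a vector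 satisfying all three is a solution. $K$ is a $Q_0$-matrix if for every $q\in\mathbb{R}^m$ for which LCP$(K,q)$ has a feasible vector, LCP$(K,q)$ has a solution. $K$ is an $R_0$-matrix if LCP$(K,0)$ has zero as its only solution, i.e. $x\ge0$, $Kx\ge0$, $x^TKx=0$ imply $x=0$. $K$ is semimonotone if for every $0\ne x\ge0$ there exists $k$ such that $x_k>0$ and $(Kx)_k\ge0$. *)

theory Defs
  imports
    "Jordan_Normal_Form.DL_Submatrix"
    "Jordan_Normal_Form.Spectral_Radius"
begin

text \<open>
  The order of \<^typ>\<open>'a vec\<close> and \<^typ>\<open>'a mat\<close> is the entrywise one and includes equality of
  dimensions; thus \<open>0\<^sub>v n \<le> x\<close> entails \<open>x \<in> carrier_vec n\<close>.
\<close>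

definition principal_submatrix :: "'a mat \<Rightarrow> nat set \<Rightarrow> 'a mat" where
  "principal_submatrix A I = submatrix A I I"

definition real_spectral_radius :: "real mat \<Rightarrow> real" where
  "real_spectral_radius B = spectral_radius (map_mat complex_of_real B)"

text \<open>
  The number \<open>\<rho>\<^bsub>m-1\<^esub>(B)\<close> for \<open>B\<close> of order \<open>m\<close>. It is meaningful for \<open>m \<ge> 2\<close> only, since
  the spectral radius of the matrix of order 0 is unspecified.
\<close>
definition rho_pred :: "real mat \<Rightarrow> real" where
  "rho_pred B = Max {real_spectral_radius (principal_submatrix B I) | I.
     I \<subseteq> {0..<dim_row B} \<and> card I = dim_row B - 1}"

definition Z_matrix :: "real mat \<Rightarrow> bool" where
  "Z_matrix A \<longleftrightarrow> square_mat A \<and>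
     (\<forall>i < dim_row A. \<forall>j < dim_row A. i \<noteq> j \<longrightarrow> A $$ (i, j) \<le> 0)"

definition Z_representation :: "real mat \<Rightarrow> real \<Rightarrow> real mat \<Rightarrow> bool" where
  "Z_representation A s B \<longleftrightarrow>
     0\<^sub>m (dim_row A) (dim_row A) \<le> B \<and> A = s \<cdot>\<^sub>m 1\<^sub>m (dim_row A) - B"

text \<open>
  A Z-matrix has many representations \<open>sI - B\<close>. For nonnegative \<open>B\<close> and \<open>t \<ge> 0\<close>, passing from
  \<open>(s, B)\<close> to \<open>(s + t, B + tI)\<close> shifts all the spectral radii involved by \<open>t\<close>, so the
  following two notions do not depend on the chosen representation.
\<close>

definition M_matrix :: "real mat \<Rightarrow> bool" where
  "M_matrix A \<longleftrightarrow> Z_matrix A \<and>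
     (\<exists>s B. Z_representation A s B \<and> real_spectral_radius B \<le> s)"

definition N0_matrix :: "real mat \<Rightarrow> bool" where
  "N0_matrix A \<longleftrightarrow> Z_matrix A \<and>
     (\<exists>s B. Z_representation A s B \<and> rho_pred B \<le> s \<and> s < real_spectral_radius B)"

definition F0_matrix :: "real mat \<Rightarrow> bool" where
  "F0_matrix A \<longleftrightarrow> Z_matrix A \<and> dim_row A \<ge> 3 \<and>
     (\<forall>I. I \<subseteq> {0..<dim_row A} \<and> I \<noteq> {} \<and> card I \<le> dim_row A - 2
        \<longrightarrow> M_matrix (principal_submatrix A I)) \<and>
     (\<exists>I. I \<subseteq> {0..<dim_row A} \<and> card I = dim_row A - 1 \<and>
        N0_matrix (principal_submatrix A I))"

definition lcp_feasible :: "real mat \<Rightarrow> real vec \<Rightarrow> real vec \<Rightarrow> bool" where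
  "lcp_feasible K q x \<longleftrightarrow>
     0\<^sub>v (dim_row K) \<le> x \<and> 0\<^sub>v (dim_row K) \<le> K *\<^sub>v x + q"

definition lcp_solution :: "real mat \<Rightarrow> real vec \<Rightarrow> real vec \<Rightarrow> bool" where
  "lcp_solution K q x \<longleftrightarrow> lcp_feasible K q x \<and> x \<bullet> (K *\<^sub>v x + q) = 0"

definition Q0_matrix :: "real mat \<Rightarrow> bool" where
  "Q0_matrix K \<longleftrightarrow> square_mat K \<and>
     (\<forall>q \<in> carrier_vec (dim_row K). (\<exists>x. lcp_feasible K q x) \<longrightarrow> (\<exists>x. lcp_solution K q x))"

definition R0_matrix :: "real mat \<Rightarrow> bool" where
  "R0_matrix K \<longleftrightarrow> square_mat K \<and>
     (\<forall>x. lcp_solution K (0\<^sub>v (dim_row K)) x \<longrightarrow> x = 0\<^sub>v (dim_row K))"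

definition semimonotone :: "real mat \<Rightarrow> bool" where
  "semimonotone K \<longleftrightarrow> square_mat K \<and>
     (\<forall>x. 0\<^sub>v (dim_row K) \<le> x \<and> x \<noteq> 0\<^sub>v (dim_row K) \<longrightarrow>
        (\<exists>k < dim_row K. x $ k > 0 \<and> (K *\<^sub>v x) $ k \<ge> 0))"

end

theory Submission
  imports Defs
begin

text \<open>
  For a Z-matrix \<open>A\<close>, being an \<open>N\<^sub>0\<close>-matrix means, in terms of nonnegative vectors \<open>z\<close>: no nonzero
  \<open>z\<close> with a zero entry has \<open>A z\<close> negative on its support, but some nonzero \<open>z\<close> does. The
  latter \<open>z\<close>, extended by \<open>0\<close>, refutes semimonotonicity of \<open>M\<close>. The two properties also give
  \<open>A\<^sup>-\<^sup>1 \<le> 0\<close> (hence the \<open>R\<^sub>0\<close> criterion) and irreducibility of \<open>A\<close>.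

  For \<open>c \<noteq> 0\<close> every problem for \<open>- M\<close> is feasible, so an unsolvable one is needed. If \<open>b = 0\<close>,
  the right-hand side \<open>A w\<close> with \<open>w > 0\<close>, \<open>A w < 0\<close> forces the first part of a solution to be \<open>w\<close>,
  and the last entry can be chosen incompatible with it. If \<open>b \<noteq> 0\<close>, then \<open>c\<^sup>T A\<^sup>-\<^sup>1 b = 0\<close> gives
  \<open>A\<^sup>-\<^sup>1\<close> a zero entry, by irreducibility even a zero diagonal entry, and then already
  \<open>- A\<close> has an unsolvable problem.
\<close>

section \<open>Matrices that are semimonotone except on full supports\<close>

text \<open>The last two assumptions express the \<open>N0_matrix\<close> property through
  nonnegative test vectors in place of spectral radii. Functions on a finite index set stand for
  vectors.\<close>

locale almost_semimonotone_Z =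
  fixes I :: "'i set" and a :: "'i \<Rightarrow> 'i \<Rightarrow> real"
  assumes finite_index: "finite I"
    and off_diagonal: "\<And>k l. k \<in> I \<Longrightarrow> l \<in> I \<Longrightarrow> k \<noteq> l \<Longrightarrow> a k l \<le> 0"
    and proper_semimonotone:
      "\<And>z i. \<lbrakk>\<forall>k\<in>I. 0 \<le> z k; i \<in> I; z i = 0; \<forall>k\<in>I. 0 < z k \<longrightarrow> (\<Sum>l\<in>I. a k l * z l) < 0\<rbrakk>
        \<Longrightarrow> \<forall>k\<in>I. z k = 0"
    and not_semimonotone:
      "\<exists>z. (\<forall>k\<in>I. 0 \<le> z k) \<and> (\<exists>k\<in>I. z k \<noteq> 0) \<and>
        (\<forall>k\<in>I. 0 < z k \<longrightarrow> (\<Sum>l\<in>I. a k l * z l) < 0)"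
begin

definition app :: "('i \<Rightarrow> real) \<Rightarrow> 'i \<Rightarrow> real" where
  "app z k = (\<Sum>l\<in>I. a k l * z l)"

lemma app_diff: "app (\<lambda>l. x l - t * y l) k = app x k - t * app y k"
  by (simp add: app_def algebra_simps sum_subtractf sum_distrib_left)

lemma app_scale: "app (\<lambda>l. t * y l) k = t * app y k"
  by (simp add: app_def algebra_simps sum_distrib_left)

lemma app_cong: "(\<And>l. l \<in> I \<Longrightarrow> x l = y l) \<Longrightarrow> app x k = app y k"
  by (simp add: app_def)

lemma app_nonpos_at_zero:
  assumes "\<And>l. l \<in> I \<Longrightarrow> 0 \<le> x l" "k \<in> I" "x k = 0"
  shows "app x k \<le> 0"
  unfolding app_def
proof (rule sum_nonpos)
  fix l assume "l \<in> I"
  then show "a k l * x l \<le> 0"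
    using assms off_diagonal[of k l] by (cases "l = k") (auto intro: mult_nonpos_nonneg)
qed

text \<open>The positive part of \<open>z\<close> meets the premises of
  \<open>proper_semimonotone\<close>: off-diagonal entries are nonpositive, so raising negative
  entries to \<open>0\<close> can only lower \<open>app z\<close> where \<open>z\<close> is
  positive. This serves below as a maximum principle for vectors of any sign.\<close>

lemma nonpos_if_nonpos_somewhere:
  assumes i: "i \<in> I" "z i \<le> 0"
    and neg: "\<And>k. k \<in> I \<Longrightarrow> 0 < z k \<Longrightarrow> app z k < 0"
    and k: "k \<in> I"
  shows "z k \<le> 0"
proof -
  let ?p = "\<lambda>l. max 0 (z l)"
  have "app ?p k < 0" if "k \<in> I" "0 < ?p k" for k
  proof -
    have zk: "0 < z k"
      using that(2) by (simp add: max_def split: if_splits)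
    have "app ?p k \<le> app z k"
      unfolding app_def
    proof (rule sum_mono)
      fix l assume "l \<in> I"
      then show "a k l * ?p l \<le> a k l * z l"
        using zk off_diagonal[OF that(1), of l]
        by (cases "l = k") (auto intro: mult_left_mono_neg)
    qed
    then show ?thesis
      using neg[OF that(1) zk] by simp
  qed
  then have "\<forall>k\<in>I. ?p k = 0"
    using i by (intro proper_semimonotone[of ?p i]) (auto simp flip: app_def)
  then show ?thesis
    using k by (metis max.cobounded2)
qed

text \<open>The vector from \<open>not_semimonotone\<close> has no zero entry, since otherwise
  \<open>proper_semimonotone\<close> would make it vanish.\<close>

lemma perron:
  obtains w where "\<And>k. k \<in> I \<Longrightarrow> 0 < w k" "\<And>k. k \<in> I \<Longrightarrow> app w k < 0"
proof -
  obtain z where z: "\<forall>k\<in>I. 0 \<le> z k" "\<exists>k\<in>I. z k \<noteq> 0"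
    "\<forall>k\<in>I. 0 < z k \<longrightarrow> app z k < 0"
    using not_semimonotone unfolding app_def by blast
  have "0 < z k" if "k \<in> I" for k
  proof (rule ccontr)
    assume "\<not> 0 < z k"
    then have "z k = 0"
      using z(1) that by force
    then have "\<forall>k\<in>I. z k = 0"
      using proper_semimonotone[OF z(1) that] z(3) by (simp add: app_def)
    then show False
      using z(2) by blast
  qed
  then show ?thesis
    using z(3) by (intro that[of z]) blast+
qed

text \<open>Subtract from the positive vector \<open>w\<close> with \<open>A w < 0\<close> the largest multiple of \<open>x\<close> that
  leaves it nonnegative.\<close>

lemma inverse_nonpos:
  assumes x: "\<And>k. k \<in> I \<Longrightarrow> 0 \<le> app x k" and "i \<in> I"
  shows "x i \<le> 0"
proof (rule ccontr)
  assume xi: "\<not> x i \<le> 0"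
  obtain w where w: "\<And>k. k \<in> I \<Longrightarrow> 0 < w k" "\<And>k. k \<in> I \<Longrightarrow> app w k < 0"
    using perron by blast
  let ?P = "{k \<in> I. 0 < x k}"
  define s where "s = Min ((\<lambda>k. w k / x k) ` ?P)"
  have fin: "finite ((\<lambda>k. w k / x k) ` ?P)" and ne: "(\<lambda>k. w k / x k) ` ?P \<noteq> {}"
    using finite_index xi \<open>i \<in> I\<close> by auto
  obtain m where m: "m \<in> I" "0 < x m" "s = w m / x m"
    using Min_in[OF fin ne] unfolding s_def by auto
  have s: "0 < s"
    using m w by simp
  have le: "s * x k \<le> w k" if "k \<in> I" "0 < x k" for k
  proof -
    have "s \<le> w k / x k"
      unfolding s_def using fin that by (intro Min_le) auto
    then show ?thesis
      using that by (simp add: field_simps)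
  qed
  let ?z = "\<lambda>k. w k - s * x k"
  have neg: "app ?z k < 0" if "k \<in> I" for k
    using w(2)[OF that] mult_nonneg_nonneg[of s "app x k"] x[OF that] s
    unfolding app_diff by linarith
  have "?z m = 0"
    using m by simp
  \<comment> \<open>Nonpositivity of \<open>?z\<close> makes every \<open>x k\<close> positive; the
    choice of \<open>s\<close> then gives the reverse inequality, and \<open>?z = 0\<close>
    contradicts \<open>neg\<close>.\<close>
  then have nonpos: "?z k \<le> 0" if "k \<in> I" for k
    using nonpos_if_nonpos_somewhere[of m ?z k, OF m(1) _ neg that] by simp
  have "?z k = 0" if "k \<in> I" for k
  proof -
    have "0 < s * x k"
      using nonpos[OF that] w(1)[OF that] by linarith
    then have "0 < x k"
      using s by (simp add: zero_less_mult_iff)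
    then show ?thesis
      using le[OF that] nonpos[OF that] by simp
  qed
  then have "app ?z m = 0"
    by (simp add: app_def)
  then show False
    using neg[OF m(1)] by linarith
qed

text \<open>Were the block with rows in \<open>Z\<close> and columns outside zero, the Perron-type
  vector \<open>w\<close> cut off outside \<open>Z\<close> would keep its negative image on
  \<open>Z\<close> while vanishing at \<open>j\<close>, against the maximum principle.\<close>

lemma irreducible:
  assumes "Z \<subseteq> I" "i \<in> Z" "j \<in> I - Z"
  shows "\<exists>k\<in>Z. \<exists>l\<in>I - Z. a k l < 0"
proof (rule ccontr)
  assume contr: "\<not> ?thesis"
  have zero: "a k l = 0" if "k \<in> Z" "l \<in> I - Z" for k l
  proof -
    have "a k l \<le> 0"
      using that assms(1) by (intro off_diagonal) auto
    moreover have "\<not> a k l < 0"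
      using contr that by blast
    ultimately show ?thesis
      by simp
  qed
  obtain w where w: "\<And>k. k \<in> I \<Longrightarrow> 0 < w k" "\<And>k. k \<in> I \<Longrightarrow> app w k < 0"
    using perron by blast
  let ?z = "\<lambda>k. if k \<in> Z then w k else 0"
  have neg: "app ?z k < 0" if "k \<in> I" "0 < ?z k" for k
  proof -
    have k: "k \<in> Z"
      using that(2) by (auto split: if_splits)
    then have "app ?z k = app w k"
      unfolding app_def using zero[OF k] by (intro sum.cong) auto
    then show ?thesis
      using w(2)[OF that(1)] by simp
  qed
  have "?z i \<le> 0"
    by (rule nonpos_if_nonpos_somewhere[of j ?z i, OF _ _ neg]) (use assms in auto)
  then have "w i \<le> 0"
    using \<open>i \<in> Z\<close> by simp
  moreover have "0 < w i"
    using w(1) assms(1,2) by blast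
  ultimately show False
    by linarith
qed

text \<open>For \<open>j\<close> in \<open>I\<close>, \<open>g\<close> is column \<open>j\<close> of
  the inverse of \<open>-A\<close>; \<open>inverse_nonpos\<close> applies to
  \<open>-g\<close>.\<close>

lemma column_nonneg:
  assumes g: "\<And>k. k \<in> I \<Longrightarrow> app g k = (if k = j then - 1 else 0)" and "i \<in> I"
  shows "0 \<le> g i"
proof -
  have "app (\<lambda>l. (- 1) * g l) k = (if k = j then 1 else 0)" if "k \<in> I" for k
    by (simp only: app_scale g[OF that]) simp
  then have "(- 1) * g i \<le> 0"
    using \<open>i \<in> I\<close> by (intro inverse_nonpos[of "\<lambda>l. (- 1) * g l"]) (simp_all only:, simp)
  then show ?thesis
    by simp
qed

text \<open>If \<open>g j\<close> were nonzero, \<open>app g\<close> would vanish on the zero set of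
  \<open>g\<close>. There it is a sum of nonpositive terms, and irreducibility makes one of them
  negative for some row.\<close>

lemma column_zero_imp_diagonal_zero:
  assumes g: "\<And>k. k \<in> I \<Longrightarrow> app g k = (if k = j then - 1 else 0)"
    and "j \<in> I" "i \<in> I" "g i = 0"
  shows "g j = 0"
proof (rule ccontr)
  assume "g j \<noteq> 0"
  let ?Z = "{k \<in> I. g k = 0}"
  obtain k l where kl: "k \<in> ?Z" "l \<in> I - ?Z" "a k l < 0"
    using irreducible[of ?Z i j] assms(2-4) \<open>g j \<noteq> 0\<close> by blast
  have nonpos: "a k m * g m \<le> 0" if "m \<in> I" for m
    using column_nonneg[OF g that] kl(1) off_diagonal[of k m] that
    by (cases "m = k") (auto intro: mult_nonpos_nonneg)
  have "0 < g l"
    using column_nonneg[OF g, of l] kl(2) by force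
  then have "a k l * g l < 0"
    using kl(3) by (simp add: mult_neg_pos)
  moreover have "app g k = a k l * g l + (\<Sum>m\<in>I - {l}. a k m * g m)"
    unfolding app_def using kl(2) finite_index by (intro sum.remove) auto
  moreover have "(\<Sum>m\<in>I - {l}. a k m * g m) \<le> 0"
    using nonpos by (intro sum_nonpos) auto
  moreover have "app g k = 0"
    using g kl(1) \<open>g j \<noteq> 0\<close> by auto
  ultimately show False
    by linarith
qed

text \<open>In the next two lemmas \<open>g\<close> is a null vector of the principal submatrix of \<open>A\<close>
  obtained by deleting the index \<open>j\<close>.\<close>

lemma zero_off_pivot:
  assumes g: "\<And>k. k \<in> I \<Longrightarrow> app g k = (if k = j then - 1 else 0)"
    and j: "j \<in> I" "g j = 0"
    and u: "\<And>k. k \<in> I \<Longrightarrow> 0 \<le> u k"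
    and support: "\<And>k. k \<in> I \<Longrightarrow> k \<noteq> j \<Longrightarrow> 0 < u k \<Longrightarrow> 0 < app u k"
  shows "\<exists>k\<in>I. k \<noteq> j \<and> u k = 0"
proof (rule ccontr)
  assume contr: "\<not> ?thesis"
  have pos: "0 < u k" if "k \<in> I" "k \<noteq> j" for k
  proof -
    have "u k \<noteq> 0"
      using contr that by blast
    then show ?thesis
      using u[OF that(1)] by simp
  qed
  let ?P = "{k \<in> I. 0 < g k}"
  have "\<exists>k\<in>I. g k \<noteq> 0"
  proof (rule ccontr)
    assume "\<not> ?thesis"
    then have "app g j = app (\<lambda>_. 0) j"
      by (intro app_cong) auto
    then show False
      using g[OF j(1)] by (simp add: app_def)
  qed
  then obtain k0 where "k0 \<in> ?P"
    using column_nonneg[OF g] by force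
  \<comment> \<open>The largest multiple of \<open>g\<close> that can be subtracted from
    \<open>u\<close>. At an index \<open>m\<close> attaining it, the difference is zero, so its
    image is nonpositive; but \<open>m\<close> differs from \<open>j\<close>, so this image equals
    \<open>app u m\<close>, which is positive.\<close>
  define s where "s = Min ((\<lambda>k. u k / g k) ` ?P)"
  have fin: "finite ((\<lambda>k. u k / g k) ` ?P)" and ne: "(\<lambda>k. u k / g k) ` ?P \<noteq> {}"
    using finite_index \<open>k0 \<in> ?P\<close> by auto
  obtain m where m: "m \<in> I" "0 < g m" "s = u m / g m"
    using Min_in[OF fin ne] unfolding s_def by auto
  have "0 \<le> u k - s * g k" if "k \<in> I" for k
  proof (cases "g k = 0")
    case False
    then have "0 < g k"
      using column_nonneg[OF g that] by simp
    moreover have "s \<le> u k / g k"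
      unfolding s_def using fin that \<open>0 < g k\<close> by (intro Min_le) auto
    ultimately show ?thesis
      by (simp add: field_simps)
  qed (use u that in simp)
  then have "app (\<lambda>k. u k - s * g k) m \<le> 0"
    using m by (intro app_nonpos_at_zero) auto
  moreover have "m \<noteq> j"
    using m j by auto
  ultimately show False
    using g[OF m(1)] support[OF m(1)] pos[OF m(1)] unfolding app_diff by simp
qed

text \<open>The right-hand side is \<open>1\<close> off \<open>j\<close> and very negative at \<open>j\<close>. Any solution has a zero
  component off \<open>j\<close>; among infinitely many values at \<open>j\<close> two have solutions \<open>u\<close>, \<open>v\<close> of equal
  support off \<open>j\<close>, and comparing \<open>v\<close> with \<open>2u\<close> bounds the second value in terms of \<open>u\<close>.\<close>

lemma unsolvable_if_diagonal_zero:
  assumes g: "\<And>k. k \<in> I \<Longrightarrow> app g k = (if k = j then - 1 else 0)"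
    and j: "j \<in> I" "g j = 0"
  shows "\<exists>p. \<nexists>u. \<forall>k\<in>I. 0 \<le> u k \<and> app u k \<le> p k \<and> (0 < u k \<longrightarrow> app u k = p k)"
proof (rule ccontr)
  assume contr: "\<not> ?thesis"
  define p where "p N k = (if k = j then - real N else 1)" for N k
  have "\<exists>u. \<forall>k\<in>I. 0 \<le> u k \<and> app u k \<le> p N k \<and> (0 < u k \<longrightarrow> app u k = p N k)" for N
    using contr by blast
  then obtain U where U: "\<And>N k. k \<in> I \<Longrightarrow> 0 \<le> U N k"
    "\<And>N k. k \<in> I \<Longrightarrow> app (U N) k \<le> p N k"
    "\<And>N k. k \<in> I \<Longrightarrow> 0 < U N k \<Longrightarrow> app (U N) k = p N k"
    by metis
  define T where "T N = {k \<in> I - {j}. 0 < U N k}" for N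
  have "finite (range T)"
    using finite_subset[of "range T" "Pow I"] finite_index by (auto simp: T_def)
  then obtain N where inf: "infinite {N'. T N' = T N}"
    using pigeonhole_infinite[of UNIV T] by auto
  let ?u = "U N"
  \<comment> \<open>The first bound makes \<open>app ?z j\<close> negative for the difference
    \<open>?z\<close> below; the second bounds \<open>- app ?v j\<close> once \<open>?v\<close> is
    at most \<open>2 * ?u\<close>.\<close>
  define C where "C = max (- 2 * app ?u j) (\<Sum>l\<in>I. \<bar>a j l\<bar> * (2 * ?u l))"
  obtain N' where N': "T N' = T N" "nat \<lceil>C\<rceil> < N'"
    using inf[unfolded infinite_nat_iff_unbounded] by auto
  then have big: "C < real N'"
    by linarith
  let ?v = "U N'"
  obtain m where m: "m \<in> I" "m \<noteq> j" "?v m = 0"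
    using zero_off_pivot[OF g j, of ?v] U(1,3)[of _ N'] by (auto simp: p_def)
  \<comment> \<open>Off \<open>j\<close>, both images equal \<open>1\<close> on the common support;
    the factor \<open>2\<close> makes the image of the difference \<open>-1\<close> there.\<close>
  let ?z = "\<lambda>k. ?v k - 2 * ?u k"
  have neg: "app ?z k < 0" if "k \<in> I" "0 < ?z k" for k
  proof (cases "k = j")
    case True
    then show ?thesis
      using U(2)[OF that(1), of N'] big unfolding app_diff C_def by (simp add: p_def)
  next
    case False
    have vk: "0 < ?v k"
      using that U(1)[OF that(1), of N] by linarith
    then have "k \<in> T N'"
      using that False by (simp add: T_def)
    then have "0 < ?u k"
      unfolding N'(1) by (simp add: T_def)
    then show ?thesis
      using U(3)[OF that(1), of N] U(3)[OF that(1), of N'] vk False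
      unfolding app_diff by (simp add: p_def)
  qed
  have le: "?v k \<le> 2 * ?u k" if "k \<in> I" for k
    using nonpos_if_nonpos_somewhere[of m ?z k, OF m(1) _ neg that] m(3) U(1)[OF m(1), of N]
    by simp
  have "- app ?v j = (\<Sum>l\<in>I. - a j l * ?v l)"
    by (simp add: app_def sum_negf)
  also have "\<dots> \<le> (\<Sum>l\<in>I. \<bar>a j l\<bar> * (2 * ?u l))"
    using le U(1) by (intro sum_mono mult_mono) auto
  also have "\<dots> \<le> C"
    by (simp add: C_def)
  finally show False
    using U(2)[OF j(1), of N'] big by (simp add: p_def)
qed

end

section \<open>Spectral radius of nonnegative matrices\<close>

text \<open>If \<mu> exceeded the spectral radius, dividing \<open>B\<close> by some
  \<open>t\<close> strictly between would give a matrix with bounded powers, whereas iterating the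
  inequality for \<open>z\<close> forces exponential growth at index \<open>i\<close>.\<close>

lemma collatz_wielandt_le:
  assumes B: "B \<in> carrier_mat m m"
    and nonneg: "\<And>i j. i < m \<Longrightarrow> j < m \<Longrightarrow> 0 \<le> B $$ (i, j)"
    and z: "\<And>i. i < m \<Longrightarrow> 0 \<le> z i" and i: "i < m" "z i \<noteq> 0"
    and le: "\<And>i. i < m \<Longrightarrow> \<mu> * z i \<le> (\<Sum>j<m. B $$ (i, j) * z j)"
  shows "\<mu> \<le> real_spectral_radius B"
proof (rule ccontr)
  define \<rho> where "\<rho> = real_spectral_radius B"
  assume "\<not> ?thesis"
  then have less: "\<rho> < \<mu>"
    by (simp add: \<rho>_def)
  have m: "0 < m"
    using i(1) by simp
  let ?C = "map_mat complex_of_real B"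
  have C: "?C \<in> carrier_mat m m"
    using B by simp
  have "0 \<le> \<rho>"
    using spectral_radius_mem_max(1)[OF C m] by (auto simp: \<rho>_def real_spectral_radius_def)
  define t where "t = (\<rho> + \<mu>) / 2"
  have t: "0 < t" "\<rho> < t" "t < \<mu>"
    using less \<open>0 \<le> \<rho>\<close> by (auto simp: t_def)
  define D where "D = (1 / t) \<cdot>\<^sub>m B"
  have D: "D \<in> carrier_mat m m"
    using B by (simp add: D_def)
  let ?E = "map_mat complex_of_real D"
  have E: "?E \<in> carrier_mat m m"
    using D by simp
  have C_eq: "?C = complex_of_real t \<cdot>\<^sub>m ?E"
    using B t(1) by (intro eq_matI) (auto simp: D_def)
  have "spectral_radius ?E < 1"
  proof -
    obtain e where e: "e \<in> spectrum ?E" "spectral_radius ?E = norm e"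
      using spectral_radius_mem_max(1)[OF E m] by auto
    then obtain v where v: "v \<in> carrier_vec m" "v \<noteq> 0\<^sub>v m" "?E *\<^sub>v v = e \<cdot>\<^sub>v v"
      using D by (auto simp: spectrum_def eigenvalue_def eigenvector_def)
    have "?C *\<^sub>v v = complex_of_real t \<cdot>\<^sub>v (?E *\<^sub>v v)"
      unfolding C_eq using E v(1) by (intro eq_vecI) auto
    then have "?C *\<^sub>v v = (complex_of_real t * e) \<cdot>\<^sub>v v"
      unfolding v(3) by (simp add: smult_smult_assoc)
    then have "complex_of_real t * e \<in> spectrum ?C"
      using v B by (auto simp: spectrum_def eigenvalue_def eigenvector_def)
    then have "norm (complex_of_real t * e) \<le> \<rho>"
      unfolding \<rho>_def real_spectral_radius_def
      using spectral_radius_mem_max(2)[OF C m] by blast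
    moreover have "norm (complex_of_real t * e) = t * norm e"
      using t(1) by (simp add: norm_mult)
    ultimately have "t * norm e < t * 1"
      using t(2) by linarith
    then show ?thesis
      using e(2) t(1) mult_less_cancel_left_pos by metis
  qed
  then obtain c where c: "\<And>k. norm_bound (?E ^\<^sub>m k) c"
    using spectral_radius_jnf_norm_bound_less_1_upper_triangular[OF E] by blast
  have Dk: "D ^\<^sub>m k \<in> carrier_mat m m" for k
    using D by simp
  have bound: "\<bar>(D ^\<^sub>m k) $$ (i, j)\<bar> \<le> c" if "i < m" "j < m" for i j k
  proof -
    have "?E ^\<^sub>m k = map_mat complex_of_real (D ^\<^sub>m k)"
      by (rule of_real_hom.mat_hom_pow[OF D, symmetric])
    then have "norm_bound (map_mat complex_of_real (D ^\<^sub>m k)) c"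
      using c[of k] by simp
    then show ?thesis
      using Dk[of k] D that by (auto simp: norm_bound_def)
  qed
  have D_nonneg: "0 \<le> D $$ (i, j)" if "i < m" "j < m" for i j
    using nonneg[OF that] t(1) B that by (simp add: D_def)
  have Suc_entry: "(D ^\<^sub>m Suc k) $$ (i, j) = (\<Sum>l<m. (D ^\<^sub>m k) $$ (i, l) * D $$ (l, j))"
    if "i < m" "j < m" for i j k
    using that D Dk[of k] by (auto simp: scalar_prod_def atLeast0LessThan intro!: sum.cong)
  have pow_nonneg: "0 \<le> (D ^\<^sub>m k) $$ (i, j)" if "i < m" "j < m" for i j k
    using that
  proof (induction k arbitrary: j)
    case (Suc k)
    then show ?case
      unfolding Suc_entry[OF Suc.prems] by (intro sum_nonneg mult_nonneg_nonneg D_nonneg) auto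
  qed (use D in auto)
  let ?r = "\<mu> / t"
  have r: "1 < ?r"
    using t by simp
  have D_le: "?r * z l \<le> (\<Sum>j<m. D $$ (l, j) * z j)" if "l < m" for l
  proof -
    have "(\<Sum>j<m. D $$ (l, j) * z j) = (1 / t) * (\<Sum>j<m. B $$ (l, j) * z j)"
      unfolding sum_distrib_left using B that by (intro sum.cong) (auto simp: D_def)
    then show ?thesis
      using le[OF that] t(1) by (simp add: field_simps)
  qed
  have growth: "?r ^ k * z i \<le> (\<Sum>j<m. (D ^\<^sub>m k) $$ (i, j) * z j)" for k
  proof (induction k)
    case 0
    have "(\<Sum>j<m. (D ^\<^sub>m 0) $$ (i, j) * z j) = (\<Sum>j<m. if j = i then z j else 0)"
      using D i(1) by (intro sum.cong) auto
    then show ?case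
      using i(1) by simp
  next
    case (Suc k)
    have "?r ^ Suc k * z i = ?r * (?r ^ k * z i)"
      by simp
    also have "\<dots> \<le> ?r * (\<Sum>l<m. (D ^\<^sub>m k) $$ (i, l) * z l)"
      using Suc.IH r by (intro mult_left_mono) auto
    also have "\<dots> = (\<Sum>l<m. (D ^\<^sub>m k) $$ (i, l) * (?r * z l))"
      by (simp add: sum_distrib_left mult_ac)
    also have "\<dots> \<le> (\<Sum>l<m. (D ^\<^sub>m k) $$ (i, l) * (\<Sum>j<m. D $$ (l, j) * z j))"
      using D_le pow_nonneg[OF i(1)] by (intro sum_mono mult_left_mono) auto
    also have "\<dots> = (\<Sum>l<m. \<Sum>j<m. (D ^\<^sub>m k) $$ (i, l) * D $$ (l, j) * z j)"
      by (simp add: sum_distrib_left mult.assoc)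
    also have "\<dots> = (\<Sum>j<m. \<Sum>l<m. (D ^\<^sub>m k) $$ (i, l) * D $$ (l, j) * z j)"
      by (rule sum.swap)
    also have "\<dots> = (\<Sum>j<m. (D ^\<^sub>m Suc k) $$ (i, j) * z j)"
      using Suc_entry[OF i(1)] by (intro sum.cong) (auto simp: sum_distrib_right)
    finally show ?case .
  qed
  have zi: "0 < z i"
    using z[OF i(1)] i(2) by simp
  have bounded: "?r ^ k \<le> (\<Sum>j<m. c * z j) / z i" for k
  proof -
    have "?r ^ k * z i \<le> (\<Sum>j<m. (D ^\<^sub>m k) $$ (i, j) * z j)"
      by (rule growth)
    also have "\<dots> \<le> (\<Sum>j<m. c * z j)"
      using bound[OF i(1), of _ k] z by (intro sum_mono mult_right_mono) (auto simp: abs_le_iff)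
    finally show ?thesis
      using zi by (simp add: field_simps)
  qed
  obtain k where "(\<Sum>j<m. c * z j) / z i < ?r ^ k"
    using real_arch_pow[OF r] by blast
  then show False
    using bounded[of k] by simp
qed

text \<open>Take the moduli of a complex eigenvector for an eigenvalue of largest modulus and use
  the triangle inequality.\<close>

lemma subinvariant_vector_exists:
  assumes B: "B \<in> carrier_mat m m" and "0 < m"
    and nonneg: "\<And>i j. i < m \<Longrightarrow> j < m \<Longrightarrow> 0 \<le> B $$ (i, j)"
  obtains z where "\<And>i. i < m \<Longrightarrow> 0 \<le> z i" "\<exists>i<m. z i \<noteq> 0"
    "\<And>i. i < m \<Longrightarrow> real_spectral_radius B * z i \<le> (\<Sum>j<m. B $$ (i, j) * z j)"
proof -
  let ?C = "map_mat complex_of_real B"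
  have C: "?C \<in> carrier_mat m m"
    using B by simp
  obtain e where e: "e \<in> spectrum ?C" "real_spectral_radius B = norm e"
    using spectral_radius_mem_max(1)[OF C \<open>0 < m\<close>] by (auto simp: real_spectral_radius_def)
  then obtain v where v: "v \<in> carrier_vec m" "v \<noteq> 0\<^sub>v m" "?C *\<^sub>v v = e \<cdot>\<^sub>v v"
    using B by (auto simp: spectrum_def eigenvalue_def eigenvector_def)
  show thesis
  proof
    show "0 \<le> norm (v $ i)" for i
      by simp
    show "\<exists>i<m. norm (v $ i) \<noteq> 0"
      using v(1,2) by (metis carrier_vecD eq_vecI index_zero_vec norm_eq_zero)
    fix i assume i: "i < m"
    have "e * v $ i = (?C *\<^sub>v v) $ i"
      unfolding v(3) using v(1) i by simp
    also have "\<dots> = (\<Sum>j<m. complex_of_real (B $$ (i, j)) * v $ j)"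
      using B v(1) i by (auto simp: scalar_prod_def atLeast0LessThan intro!: sum.cong)
    finally have "norm e * norm (v $ i) = norm (\<Sum>j<m. complex_of_real (B $$ (i, j)) * v $ j)"
      by (metis norm_mult)
    also have "\<dots> \<le> (\<Sum>j<m. norm (complex_of_real (B $$ (i, j)) * v $ j))"
      by (rule norm_sum)
    also have "\<dots> = (\<Sum>j<m. B $$ (i, j) * norm (v $ j))"
      using nonneg i by (intro sum.cong) (auto simp: norm_mult)
    finally show "real_spectral_radius B * norm (v $ i) \<le> (\<Sum>j<m. B $$ (i, j) * norm (v $ j))"
      unfolding e(2) .
  qed
qed

section \<open>Principal submatrices and the test-vector form of the \<open>N0_matrix\<close>
  property\<close>

lemma bij_betw_pick:
  assumes "finite I"
  shows "bij_betw (pick I) {..<card I} I"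
proof -
  have inj: "inj_on (pick I) {..<card I}"
    using pick_mono[of _ I] by (intro linorder_inj_onI') (metis lessThan_iff less_irrefl)
  moreover have "pick I ` {..<card I} = I"
    using assms pick_in_set[of _ I] card_image[OF inj]
    by (intro card_subset_eq) auto
  ultimately show ?thesis
    by (simp add: bij_betw_def)
qed

lemma rho_pred_upper:
  assumes "I \<subseteq> {0..<dim_row B}" "card I = dim_row B - 1"
  shows "real_spectral_radius (principal_submatrix B I) \<le> rho_pred B"
proof -
  let ?S = "{I. I \<subseteq> {0..<dim_row B} \<and> card I = dim_row B - 1}"
  have "finite ?S"
    by (rule finite_subset[of _ "Pow {0..<dim_row B}"]) auto
  then have "finite ((\<lambda>I. real_spectral_radius (principal_submatrix B I)) ` ?S)"
    by simp
  then show ?thesis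
    unfolding rho_pred_def using assms by (intro Max_ge) (auto simp: setcompr_eq_image)
qed

text \<open>As \<open>z\<close> vanishes outside \<open>I\<close>, its restriction to
  \<open>I\<close>, reindexed by \<open>pick I\<close>, is a test vector for the submatrix.\<close>

lemma principal_submatrix_collatz_wielandt_le:
  assumes B: "B \<in> carrier_mat n n"
    and nonneg: "\<And>i j. i < n \<Longrightarrow> j < n \<Longrightarrow> 0 \<le> B $$ (i, j)"
    and z: "\<And>i. i < n \<Longrightarrow> 0 \<le> z i" and k: "k < n" "z k \<noteq> 0"
    and le: "\<And>i. i < n \<Longrightarrow> \<mu> * z i \<le> (\<Sum>j<n. B $$ (i, j) * z j)"
    and I: "I \<subseteq> {..<n}" "\<And>i. i < n \<Longrightarrow> i \<notin> I \<Longrightarrow> z i = 0"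
  shows "\<mu> \<le> real_spectral_radius (principal_submatrix B I)"
proof -
  have fin: "finite I"
    using I(1) finite_subset by blast
  have dim: "{i. i < n \<and> i \<in> I} = I"
    using I(1) by auto
  let ?P = "principal_submatrix B I" and ?m = "card I"
  have P: "?P \<in> carrier_mat ?m ?m"
    using carrier_matD[OF B]
    by (intro carrier_matI) (simp_all add: principal_submatrix_def dim_submatrix dim)
  have entry: "?P $$ (i, j) = B $$ (pick I i, pick I j)" if "i < ?m" "j < ?m" for i j
    unfolding principal_submatrix_def using that carrier_matD[OF B]
    by (intro submatrix_index) (simp_all add: dim)
  note bij = bij_betw_pick[OF fin]
  have pick: "pick I i < n" if "i < ?m" for i
    using pick_in_set[of i I] that I(1) by auto
  have "k \<in> I"
    using k I(2) by blast
  then obtain k' where k': "k' < ?m" "pick I k' = k"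
    using bij by (metis bij_betw_iff_bijections lessThan_iff)
  show ?thesis
  proof (rule collatz_wielandt_le[OF P, where z = "\<lambda>i. z (pick I i)" and i = k'])
    fix i assume i: "i < ?m"
    have "(\<Sum>j<n. B $$ (pick I i, j) * z j) = (\<Sum>j\<in>I. B $$ (pick I i, j) * z j)"
      using I by (intro sum.mono_neutral_right) auto
    also have "\<dots> = (\<Sum>j<?m. B $$ (pick I i, pick I j) * z (pick I j))"
      by (rule sum.reindex_bij_betw[OF bij, symmetric])
    also have "\<dots> = (\<Sum>j<?m. ?P $$ (i, j) * z (pick I j))"
      using entry[OF i] by simp
    finally show "\<mu> * z (pick I i) \<le> (\<Sum>j<?m. ?P $$ (i, j) * z (pick I j))"
      using le[OF pick[OF i]] by simp
  qed (use entry nonneg pick z k' k(2) in auto)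
qed

text \<open>With \<open>A = sI - B\<close>, a negative entry of \<open>A z\<close> means that
  \<open>B z\<close> exceeds \<open>s z\<close> there. If \<open>z\<close> has a zero entry, this
  pushes \<open>rho_pred B\<close> above \<open>s\<close>; conversely, the subinvariant vector of
  \<open>B\<close> has negative image on its support because \<open>s\<close> is below the spectral
  radius.\<close>

lemma N0_matrix_almost_semimonotone_Z:
  assumes A: "A \<in> carrier_mat n n" and N0: "N0_matrix A" and n: "2 \<le> n"
  shows "almost_semimonotone_Z {..<n} (\<lambda>i j. A $$ (i, j))"
proof -
  have dimA: "dim_row A = n" "dim_col A = n"
    using A by auto
  obtain s B where repr: "Z_representation A s B"
    and s: "rho_pred B \<le> s" "s < real_spectral_radius B"
    using N0 unfolding N0_matrix_def by blast
  have le: "0\<^sub>m n n \<le> B" and A_eq: "A = s \<cdot>\<^sub>m 1\<^sub>m n - B"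
    using repr unfolding Z_representation_def dimA by auto
  have B: "B \<in> carrier_mat n n"
    using le by (intro carrier_matI) (simp_all add: less_eq_mat_def)
  have nonneg: "0 \<le> B $$ (i, j)" if "i < n" "j < n" for i j
    using le that unfolding less_eq_mat_def carrier_matD[OF B] by auto
  have entry: "A $$ (i, j) = (if i = j then s else 0) - B $$ (i, j)" if "i < n" "j < n" for i j
    unfolding A_eq using that carrier_matD[OF B] by simp
  have app: "(\<Sum>l<n. A $$ (k, l) * z l) = s * z k - (\<Sum>l<n. B $$ (k, l) * z l)"
    if k: "k < n" for k z
  proof -
    have "(\<Sum>l<n. A $$ (k, l) * z l) = (\<Sum>l<n. (if l = k then s * z l else 0) - B $$ (k, l) * z l)"
      by (intro sum.cong) (auto simp: entry[OF k] left_diff_distrib)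
    then show ?thesis
      using k by (simp add: sum_subtractf)
  qed
  show ?thesis
  proof
    show "A $$ (k, l) \<le> 0" if "k \<in> {..<n}" "l \<in> {..<n}" "k \<noteq> l" for k l
      using that N0 unfolding N0_matrix_def Z_matrix_def dimA by simp
  next
    fix z :: "nat \<Rightarrow> real" and i
    assume z: "\<forall>k\<in>{..<n}. 0 \<le> z k" and i: "i \<in> {..<n}" "z i = 0"
      and neg: "\<forall>k\<in>{..<n}. 0 < z k \<longrightarrow> (\<Sum>l<n. A $$ (k, l) * z l) < 0"
    show "\<forall>k\<in>{..<n}. z k = 0"
    proof (rule ccontr)
      assume "\<not> ?thesis"
      then obtain k where k: "k < n" "z k \<noteq> 0"
        by auto
      let ?y = "\<lambda>k. \<Sum>l<n. B $$ (k, l) * z l"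
      let ?Q = "(\<lambda>k. ?y k / z k) ` {k \<in> {..<n}. 0 < z k}"
      have fin: "finite ?Q"
        by simp
      have "0 < z k"
        using z k by force
      then have ne: "?Q \<noteq> {}"
        using k(1) by blast
      \<comment> \<open>The Collatz-Wielandt quotient of \<open>z\<close>, taken over its support
        only; off the support the inequality holds because \<open>B z\<close> is
        nonnegative.\<close>
      define \<mu> where "\<mu> = Min ?Q"
      have "s < \<mu>"
        unfolding \<mu>_def Min_gr_iff[OF fin ne]
      proof
        fix q assume "q \<in> ?Q"
        then obtain m where m: "m < n" "0 < z m" "q = ?y m / z m"
          by auto
        then have "s * z m < ?y m"
          using neg app[of m z] by auto
        then show "s < q"
          using m(2,3) by (simp only: less_divide_eq if_True)
      qed
      have \<mu>_le: "\<mu> * z m \<le> ?y m" if m: "m < n" for m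
      proof (cases "z m = 0")
        case True
        have "0 \<le> ?y m"
          using nonneg[OF m] z by (intro sum_nonneg mult_nonneg_nonneg) auto
        then show ?thesis
          using True by simp
      next
        case False
        then have zm: "0 < z m"
          using z m by force
        then have "\<mu> \<le> ?y m / z m"
          unfolding \<mu>_def using m by (intro Min_le[OF fin]) blast
        then show ?thesis
          using zm by (simp add: field_simps)
      qed
      let ?I = "{..<n} - {i}"
      have "\<mu> \<le> real_spectral_radius (principal_submatrix B ?I)"
      proof (rule principal_submatrix_collatz_wielandt_le[OF B nonneg _ k \<mu>_le])
        show "z m = 0" if "m < n" "m \<notin> ?I" for m
          using that i(2) by auto
      qed (use z in auto)
      also have "\<dots> \<le> rho_pred B"
        using i(1) carrier_matD[OF B] by (intro rho_pred_upper) auto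
      finally show False
        using s(1) \<open>s < \<mu>\<close> by linarith
    qed
  next
    have "0 < n"
      using n by simp
    obtain z where z: "\<And>i. i < n \<Longrightarrow> 0 \<le> z i" "\<exists>i<n. z i \<noteq> 0"
      "\<And>i. i < n \<Longrightarrow> real_spectral_radius B * z i \<le> (\<Sum>j<n. B $$ (i, j) * z j)"
      using subinvariant_vector_exists[OF B \<open>0 < n\<close> nonneg] by blast
    have "(\<Sum>l<n. A $$ (k, l) * z l) < 0" if k: "k < n" "0 < z k" for k
      using z(3)[OF k(1)] mult_strict_right_mono[OF s(2) k(2)] unfolding app[OF k(1)] by linarith
    then show "\<exists>z. (\<forall>k\<in>{..<n}. 0 \<le> z k) \<and> (\<exists>k\<in>{..<n}. z k \<noteq> 0) \<and>
        (\<forall>k\<in>{..<n}. 0 < z k \<longrightarrow> (\<Sum>l<n. A $$ (k, l) * z l) < 0)"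
      using z(1,2) by (intro exI[of _ z]) auto
  qed simp
qed

section \<open>Linear complementarity and linear systems in coordinates\<close>

lemma mult_mat_vec_index_sum:
  assumes "K \<in> carrier_mat r m" "x \<in> carrier_vec m" "k < r"
  shows "(K *\<^sub>v x) $ k = (\<Sum>l<m. K $$ (k, l) * x $ l)"
  using assms by (auto simp: scalar_prod_def atLeast0LessThan intro!: sum.cong)

lemma lcp_feasible_iff:
  assumes "K \<in> carrier_mat m m" "q \<in> carrier_vec m"
  shows "lcp_feasible K q x \<longleftrightarrow>
    x \<in> carrier_vec m \<and> (\<forall>k<m. 0 \<le> x $ k \<and> 0 \<le> (K *\<^sub>v x) $ k + q $ k)"
  using carrier_matD[OF assms(1)] carrier_vecD[OF assms(2)]
  unfolding lcp_feasible_def less_eq_vec_def carrier_vec_def by auto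

lemma lcp_solution_iff:
  assumes K: "K \<in> carrier_mat m m" and q: "q \<in> carrier_vec m"
  shows "lcp_solution K q x \<longleftrightarrow> x \<in> carrier_vec m \<and>
    (\<forall>k<m. 0 \<le> x $ k \<and> 0 \<le> (K *\<^sub>v x) $ k + q $ k \<and> (0 < x $ k \<longrightarrow> (K *\<^sub>v x) $ k + q $ k = 0))"
proof (cases "lcp_feasible K q x")
  case True
  then have x: "\<forall>k<m. 0 \<le> x $ k \<and> 0 \<le> (K *\<^sub>v x) $ k + q $ k"
    unfolding lcp_feasible_iff[OF assms] by blast
  have "x \<bullet> (K *\<^sub>v x + q) = (\<Sum>k<m. x $ k * ((K *\<^sub>v x) $ k + q $ k))"
    unfolding scalar_prod_def atLeast0LessThan using carrier_vecD[OF q] by simp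
  also have "\<dots> = 0 \<longleftrightarrow> (\<forall>k\<in>{..<m}. x $ k * ((K *\<^sub>v x) $ k + q $ k) = 0)"
    using x by (intro sum_nonneg_eq_0_iff) auto
  also have "\<dots> \<longleftrightarrow> (\<forall>k<m. 0 < x $ k \<longrightarrow> (K *\<^sub>v x) $ k + q $ k = 0)"
    using x by (metis lessThan_iff less_eq_real_def less_irrefl mult_eq_0_iff)
  finally show ?thesis
    using True unfolding lcp_solution_def lcp_feasible_iff[OF assms] by blast
next
  case False
  then show ?thesis
    unfolding lcp_solution_def lcp_feasible_iff[OF assms] by blast
qed

lemma nonsingular_solvable:
  fixes A :: "'a::field mat"
  assumes A: "A \<in> carrier_mat n n" and det: "det A \<noteq> 0" and v: "v \<in> carrier_vec n"
  shows "\<exists>x\<in>carrier_vec n. A *\<^sub>v x = v"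
proof -
  obtain B where B: "B \<in> carrier_mat n n" "A * B = 1\<^sub>m n"
    using det_non_zero_imp_unit[OF A det, of "()"]
    by (auto simp: Units_def ring_mat_simps)
  have "A *\<^sub>v (B *\<^sub>v v) = v"
    using A B v by (simp flip: assoc_mult_mat_vec)
  then show ?thesis
    using B(1) v by (intro bexI[of _ "B *\<^sub>v v"]) auto
qed

section \<open>Bordering an \<open>N\<^sub>0\<close>-matrix\<close>

locale bordered_N0 =
  fixes n :: nat and A M :: "real mat" and b c :: "real vec"
  assumes A: "A \<in> carrier_mat n n" and N0: "N0_matrix A" and n: "2 \<le> n"
    and b: "b \<in> carrier_vec n" "b \<le> 0\<^sub>v n"
    and c: "c \<in> carrier_vec n" "c \<le> 0\<^sub>v n"
    and M_eq: "M = four_block_mat A (mat_of_cols n [b]) (mat_of_rows n [c]) (0\<^sub>m 1 1)"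
    and singular: "det M = 0"
begin

sublocale almost_semimonotone_Z "{..<n}" "\<lambda>i j. A $$ (i, j)"
  by (rule N0_matrix_almost_semimonotone_Z[OF A N0 n])

lemma M: "M \<in> carrier_mat (Suc n) (Suc n)"
  unfolding M_eq using carrier_matD[OF A] by (intro carrier_matI) simp_all

lemma b_nonpos: "k < n \<Longrightarrow> b $ k \<le> 0"
  using b unfolding less_eq_vec_def by auto

lemma c_nonpos: "k < n \<Longrightarrow> c $ k \<le> 0"
  using c unfolding less_eq_vec_def by auto

lemma M_upper:
  assumes x: "x \<in> carrier_vec (Suc n)" and k: "k < n"
  shows "(M *\<^sub>v x) $ k = app (($) x) k + b $ k * x $ n"
proof -
  have "(M *\<^sub>v x) $ k = (\<Sum>l<n. M $$ (k, l) * x $ l) + M $$ (k, n) * x $ n"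
    using mult_mat_vec_index_sum[OF M x, of k] k by simp
  moreover have "M $$ (k, l) = A $$ (k, l)" if "l < n" for l
    unfolding M_eq using carrier_matD[OF A] k that by simp
  moreover have "M $$ (k, n) = b $ k"
    unfolding M_eq using carrier_matD[OF A] k by (simp add: mat_of_cols_def)
  ultimately show ?thesis
    by (simp add: app_def)
qed

lemma M_lower:
  assumes x: "x \<in> carrier_vec (Suc n)"
  shows "(M *\<^sub>v x) $ n = (\<Sum>l<n. c $ l * x $ l)"
proof -
  have "(M *\<^sub>v x) $ n = (\<Sum>l<n. M $$ (n, l) * x $ l) + M $$ (n, n) * x $ n"
    using mult_mat_vec_index_sum[OF M x, of n] by simp
  moreover have "M $$ (n, l) = c $ l" if "l < n" for l
    unfolding M_eq using carrier_matD[OF A] that by (simp add: mat_of_rows_def)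
  moreover have "M $$ (n, n) = 0"
    unfolding M_eq using carrier_matD[OF A] by simp
  ultimately show ?thesis
    by simp
qed

lemma border_nonpos:
  assumes "\<And>l. l < n \<Longrightarrow> 0 \<le> u l"
  shows "(\<Sum>l<n. c $ l * u l) \<le> 0"
  using assms c_nonpos by (intro sum_nonpos mult_nonpos_nonneg) auto

text \<open>Apply \<open>inverse_nonpos\<close> to both \<open>x\<close> and
  \<open>-x\<close>.\<close>

lemma A_kernel:
  assumes "\<And>k. k < n \<Longrightarrow> app x k = 0" "k < n"
  shows "x k = 0"
proof -
  have "x k \<le> 0"
    using assms by (intro inverse_nonpos) auto
  moreover have "(- 1) * x k \<le> 0"
  proof (rule inverse_nonpos[of "\<lambda>k. (- 1) * x k"])
    show "0 \<le> app (\<lambda>k. (- 1) * x k) i" if "i \<in> {..<n}" for i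
      using assms(1)[of i] that by (simp only: app_scale) simp
  qed (use assms in simp)
  ultimately show ?thesis
    by simp
qed

lemma app_mult_mat_vec: "x \<in> carrier_vec n \<Longrightarrow> k < n \<Longrightarrow> (A *\<^sub>v x) $ k = app (($) x) k"
  by (simp only: mult_mat_vec_index_sum[OF A] app_def)

lemma A_solvable: "\<exists>x. \<forall>k<n. app x k = p k"
proof -
  have "det A \<noteq> 0"
  proof
    assume "det A = 0"
    then obtain v where v: "v \<in> carrier_vec n" "v \<noteq> 0\<^sub>v n" "A *\<^sub>v v = 0\<^sub>v n"
      using det_0_iff_vec_prod_zero_field[OF A] by blast
    have "app (($) v) k = 0" if "k < n" for k
      using app_mult_mat_vec[OF v(1) that] v(3) that by simp
    then have "v $ k = 0" if "k < n" for k
      using A_kernel[of "($) v"] that by blast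
    then have "v = 0\<^sub>v n"
      using v(1) by (intro eq_vecI) auto
    then show False
      using v(2) by simp
  qed
  then obtain x where x: "x \<in> carrier_vec n" "A *\<^sub>v x = vec n p"
    using nonsingular_solvable[OF A, of "vec n p"] by auto
  have "\<forall>k<n. app (($) x) k = p k"
    using app_mult_mat_vec[OF x(1)] x(2) by (metis index_vec)
  then show ?thesis
    by blast
qed

lemma A_column:
  obtains g where "\<And>k. k < n \<Longrightarrow> app g k = (if k = j then - 1 else 0)"
  using A_solvable[of "\<lambda>k. if k = j then - 1 else 0"] by blast

text \<open>As \<open>A\<close> is nonsingular, a null vector of \<open>M\<close> can be normalised to have last entry \<open>- 1\<close>.\<close>

lemma null_vector:
  obtains d where "\<And>k. k < n \<Longrightarrow> app d k = b $ k" "\<And>k. k < n \<Longrightarrow> 0 \<le> d k"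
    "\<And>k. k < n \<Longrightarrow> c $ k * d k = 0"
proof -
  obtain x where x: "x \<in> carrier_vec (Suc n)" "x \<noteq> 0\<^sub>v (Suc n)" "M *\<^sub>v x = 0\<^sub>v (Suc n)"
    using det_0_iff_vec_prod_zero_field[OF M] singular by blast
  have upper: "app (($) x) k + b $ k * x $ n = 0" if "k < n" for k
    using M_upper[OF x(1) that] x(3) that by simp
  have lower: "(\<Sum>l<n. c $ l * x $ l) = 0"
    using M_lower[OF x(1)] x(3) by simp
  have xn: "x $ n \<noteq> 0"
  proof
    assume xn: "x $ n = 0"
    then have "x $ k = 0" if "k < n" for k
      using A_kernel[of "($) x" k] upper that by simp
    then have "x $ k = 0" if "k < Suc n" for k
      using that xn less_Suc_eq by auto
    then have "x = 0\<^sub>v (Suc n)"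
      using x(1) by (intro eq_vecI) auto
    then show False
      using x(2) by simp
  qed
  \<comment> \<open>The sign is chosen so that \<open>A\<close> maps \<open>?d\<close> to
    \<open>b\<close>; as \<open>b\<close> is nonpositive, \<open>inverse_nonpos\<close> makes
    \<open>?d\<close> nonnegative.\<close>
  let ?d = "\<lambda>k. (- 1 / x $ n) * x $ k"
  have app_d: "app ?d k = b $ k" if "k < n" for k
  proof -
    have "app ?d k = (- 1 / x $ n) * app (($) x) k"
      by (rule app_scale)
    also have "app (($) x) k = - (b $ k * x $ n)"
      using upper[OF that] by linarith
    finally show ?thesis
      using xn by simp
  qed
  have d: "0 \<le> ?d k" if "k < n" for k
  proof -
    have "(- 1) * ?d k \<le> 0"
    proof (rule inverse_nonpos[of "\<lambda>k. (- 1) * ?d k"])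
      show "0 \<le> app (\<lambda>k. (- 1) * ?d k) i" if "i \<in> {..<n}" for i
        using app_scale[of "- 1" ?d i] app_d[of i] b_nonpos[of i] that by simp
    qed (use that in simp)
    then show ?thesis
      by linarith
  qed
  have "(\<Sum>l<n. c $ l * ?d l) = (- 1 / x $ n) * (\<Sum>l<n. c $ l * x $ l)"
    by (simp add: sum_distrib_left mult_ac)
  \<comment> \<open>A vanishing sum of nonnegative terms: each product is zero.\<close>
  then have "(\<Sum>l<n. - (c $ l * ?d l)) = 0"
    unfolding lower sum_negf by simp
  moreover have "0 \<le> - (c $ l * ?d l)" if "l < n" for l
    using mult_nonpos_nonneg[OF c_nonpos[OF that] d[OF that]] by linarith
  ultimately have "\<forall>l\<in>{..<n}. - (c $ l * ?d l) = 0"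
    by (subst (asm) sum_nonneg_eq_0_iff) auto
  then have "c $ k * ?d k = 0" if "k < n" for k
    using that by (metis lessThan_iff neg_equal_0_iff_equal)
  then show thesis
    using that[of ?d] app_d d by blast
qed

text \<open>For \<open>b = 0\<close> the last unit vector is a nonzero solution. Otherwise, a
  solution \<open>(u, t)\<close> has \<open>A u\<close> at least \<open>- t b\<close>, hence
  nonnegative, so \<open>u = 0\<close>; a negative entry of \<open>b\<close> then gives
  \<open>t = 0\<close>.\<close>

lemma R0_matrix_iff: "R0_matrix M \<longleftrightarrow> b \<noteq> 0\<^sub>v n"
proof
  assume R0: "R0_matrix M"
  show "b \<noteq> 0\<^sub>v n"
  proof
    assume b0: "b = 0\<^sub>v n"
    let ?x = "unit_vec (Suc n) n :: real vec"
    have x: "?x \<in> carrier_vec (Suc n)"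
      by simp
    have "app (($) ?x) k = 0" for k
      by (simp add: app_def)
    then have "(M *\<^sub>v ?x) $ k = 0" if "k < n" for k
      using M_upper[OF x that] that b0 by simp
    moreover have "(M *\<^sub>v ?x) $ n = 0"
      using M_lower[OF x] by simp
    ultimately have "(M *\<^sub>v ?x) $ k = 0" if "k < Suc n" for k
      using that less_Suc_eq by auto
    then have "lcp_solution M (0\<^sub>v (Suc n)) ?x"
      using lcp_solution_iff[OF M, of "0\<^sub>v (Suc n)" ?x] by simp
    then have "?x = 0\<^sub>v (Suc n)"
      using R0 carrier_matD[OF M] unfolding R0_matrix_def by simp
    then show False
      by (metis index_unit_vec(1) index_zero_vec(1) lessI zero_neq_one)
  qed
next
  assume "b \<noteq> 0\<^sub>v n"
  then obtain j where j: "j < n" "b $ j \<noteq> 0"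
    using b(1) by (metis carrier_vecD eq_vecI index_zero_vec)
  have "x = 0\<^sub>v (Suc n)" if "lcp_solution M (0\<^sub>v (Suc n)) x" for x
  proof -
    have x: "x \<in> carrier_vec (Suc n)" "\<And>k. k < Suc n \<Longrightarrow> 0 \<le> x $ k"
      "\<And>k. k < Suc n \<Longrightarrow> 0 \<le> (M *\<^sub>v x) $ k"
      using that lcp_solution_iff[OF M, of "0\<^sub>v (Suc n)" x] by auto
    have t: "b $ k * x $ n \<le> 0" if "k < n" for k
      using b_nonpos[OF that] x(2)[of n] by (simp add: mult_nonpos_nonneg)
    have nonneg: "0 \<le> app (($) x) k + b $ k * x $ n" if "k < n" for k
      using x(3)[of k] M_upper[OF x(1) that] that by simp
    have u: "x $ k = 0" if "k < n" for k
    proof -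
      have "x $ k \<le> 0"
      proof (rule inverse_nonpos)
        show "0 \<le> app (($) x) i" if "i \<in> {..<n}" for i
          using nonneg[of i] t[of i] that by simp
      qed (use that in simp)
      then show ?thesis
        using x(2)[of k] that by simp
    qed
    then have "0 \<le> b $ j * x $ n"
      using nonneg[OF j(1)] by (simp add: app_def)
    then have "x $ n = 0"
      using t[OF j(1)] j(2) by simp
    then have "x $ k = 0" if "k < Suc n" for k
      using u that less_Suc_eq by auto
    then show ?thesis
      using x(1) by (intro eq_vecI) auto
  qed
  then show "R0_matrix M"
    using carrier_matD[OF M] unfolding R0_matrix_def by simp
qed

lemma not_semimonotone_M: "\<not> semimonotone M"
proof
  assume semi: "semimonotone M"
  obtain w where w: "\<And>k. k \<in> {..<n} \<Longrightarrow> 0 < w k" "\<And>k. k \<in> {..<n} \<Longrightarrow> app w k < 0"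
    using perron by blast
  let ?x = "vec (Suc n) (\<lambda>k. if k < n then w k else 0)"
  have x: "?x \<in> carrier_vec (Suc n)"
    by simp
  have "0\<^sub>v (Suc n) \<le> ?x"
    using w(1) by (auto simp: less_eq_vec_def less_imp_le)
  moreover have "?x \<noteq> 0\<^sub>v (Suc n)"
  proof
    assume "?x = 0\<^sub>v (Suc n)"
    then have "?x $ 0 = 0"
      by simp
    then show False
      using w(1)[of 0] n by simp
  qed
  ultimately obtain k where k: "k < Suc n" "0 < ?x $ k" "0 \<le> (M *\<^sub>v ?x) $ k"
    using semi carrier_matD[OF M] unfolding semimonotone_def by auto
  have "k < n"
    using k(1,2) by (simp split: if_splits)
  moreover have "app (($) ?x) k = app w k"
    by (rule app_cong) simp
  ultimately show False
    using M_upper[OF x \<open>k < n\<close>] w(2)[of k] k(3) by simp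
qed

text \<open>For \<open>c \<noteq> 0\<close> the positive vector \<open>w\<close> with \<open>A w < 0\<close>, extended by \<open>0\<close>, has
  \<open>- M (w, 0) > 0\<close>, so that every linear complementarity problem for \<open>- M\<close> is feasible.\<close>

lemma Q0_solution:
  assumes Q0: "Q0_matrix (- M)" and "c \<noteq> 0\<^sub>v n"
  obtains u t where "\<And>k. k < n \<Longrightarrow> 0 \<le> u k" "0 \<le> t"
    "\<And>k. k < n \<Longrightarrow> app u k + b $ k * t \<le> p k"
    "\<And>k. k < n \<Longrightarrow> 0 < u k \<Longrightarrow> app u k + b $ k * t = p k"
    "(\<Sum>l<n. c $ l * u l) \<le> r" "0 < t \<Longrightarrow> (\<Sum>l<n. c $ l * u l) = r"
proof -
  let ?q = "vec (Suc n) (\<lambda>k. if k < n then p k else r)"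
  have q: "?q \<in> carrier_vec (Suc n)"
    by simp
  have uM: "- M \<in> carrier_mat (Suc n) (Suc n)"
    using M by simp
  have neg: "(- M *\<^sub>v x) $ k = - (M *\<^sub>v x) $ k" if "x \<in> carrier_vec (Suc n)" "k < Suc n" for x k
    using carrier_matD[OF M] that by simp
  obtain w where w: "\<And>k. k \<in> {..<n} \<Longrightarrow> 0 < w k" "\<And>k. k \<in> {..<n} \<Longrightarrow> app w k < 0"
    using perron by blast
  obtain i where i: "i < n" "c $ i \<noteq> 0"
    using c(1) \<open>c \<noteq> 0\<^sub>v n\<close> by (metis carrier_vecD eq_vecI index_zero_vec)
  have cw: "(\<Sum>l<n. c $ l * w l) < 0"
  proof -
    have "(\<Sum>l<n. c $ l * w l) = c $ i * w i + (\<Sum>l\<in>{..<n} - {i}. c $ l * w l)"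
      using i(1) by (intro sum.remove) auto
    moreover have "(\<Sum>l\<in>{..<n} - {i}. c $ l * w l) \<le> 0"
      using c_nonpos w(1) by (intro sum_nonpos mult_nonpos_nonneg) (auto simp: less_imp_le)
    moreover have "c $ i * w i < 0"
      using i c_nonpos[OF i(1)] w(1)[of i] by (intro mult_neg_pos) auto
    ultimately show ?thesis
      by linarith
  qed
  \<comment> \<open>This is the image of \<open>(w, 0)\<close> under \<open>M\<close>, negative in
    every entry.\<close>
  define y where "y k = (if k < n then app w k else (\<Sum>l<n. c $ l * w l))" for k
  have y: "y k < 0" for k
    using w(2) cw by (simp add: y_def)
  \<comment> \<open>A crude bound for all quotients of \<open>?q\<close> by \<open>y\<close>, so
    that scaling \<open>(w, 0)\<close> by \<theta> gives a feasible vector.\<close>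
  define \<theta> where "\<theta> = (\<Sum>k<Suc n. \<bar>?q $ k / y k\<bar>)"
  have \<theta>: "0 \<le> - \<theta> * y k + ?q $ k" if "k < Suc n" for k
  proof -
    have "\<bar>?q $ k / y k\<bar> \<le> \<theta>"
      unfolding \<theta>_def using that by (intro member_le_sum) auto
    then have "?q $ k / y k \<le> \<theta>"
      by linarith
    then have "\<theta> * y k \<le> ?q $ k"
      using y[of k] by (simp only: neg_divide_le_eq)
    then show ?thesis
      by simp
  qed
  have \<theta>0: "0 \<le> \<theta>"
    unfolding \<theta>_def by (intro sum_nonneg) simp
  let ?x = "vec (Suc n) (\<lambda>k. if k < n then \<theta> * w k else 0)"
  have x: "?x \<in> carrier_vec (Suc n)"
    by simp
  have "app (($) ?x) k = app (\<lambda>l. \<theta> * w l) k" for k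
    by (rule app_cong) simp
  then have "(M *\<^sub>v ?x) $ k = \<theta> * y k" if "k < n" for k
    using M_upper[OF x that] that by (simp add: app_scale y_def)
  moreover have "(M *\<^sub>v ?x) $ n = \<theta> * y n"
    using M_lower[OF x] by (simp add: y_def sum_distrib_left mult_ac)
  ultimately have Mx: "(M *\<^sub>v ?x) $ k = \<theta> * y k" if "k < Suc n" for k
    using that less_Suc_eq by auto
  have "lcp_feasible (- M) ?q ?x"
    unfolding lcp_feasible_iff[OF uM q]
  proof (intro conjI allI impI)
    fix k assume k: "k < Suc n"
    show "0 \<le> ?x $ k"
      using k w(1) \<theta>0 by (simp add: less_imp_le)
    show "0 \<le> (- M *\<^sub>v ?x) $ k + ?q $ k"
      unfolding neg[OF x k] Mx[OF k] using \<theta>[OF k] by linarith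
  qed (rule x)
  then obtain x where sol: "lcp_solution (- M) ?q x"
    using Q0 carrier_matD[OF uM] q unfolding Q0_matrix_def by metis
  have x: "x \<in> carrier_vec (Suc n)" and x_nonneg: "\<And>k. k < Suc n \<Longrightarrow> 0 \<le> x $ k"
    and le: "\<And>k. k < Suc n \<Longrightarrow> (M *\<^sub>v x) $ k \<le> ?q $ k"
    and eq: "\<And>k. k < Suc n \<Longrightarrow> 0 < x $ k \<Longrightarrow> (M *\<^sub>v x) $ k = ?q $ k"
    using sol[unfolded lcp_solution_iff[OF uM q]] neg by fastforce+
  show thesis
  proof (rule that[of "($) x" "x $ n"])
    show "0 \<le> x $ n"
      using x_nonneg by simp
    show "(\<Sum>l<n. c $ l * x $ l) \<le> r"
      using le[of n] M_lower[OF x] by simp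
    show "(\<Sum>l<n. c $ l * x $ l) = r" if "0 < x $ n"
      using eq[of n] M_lower[OF x] that by simp
    fix k assume k: "k < n"
    show "0 \<le> x $ k"
      using x_nonneg k by simp
    show "app (($) x) k + b $ k * x $ n \<le> p k"
      using le[of k] M_upper[OF x k] k by simp
    show "app (($) x) k + b $ k * x $ n = p k" if "0 < x $ k"
      using eq[of k] M_upper[OF x k] k that by simp
  qed
qed

lemma not_Q0_matrix_border_zero:
  assumes "b = 0\<^sub>v n" "c \<noteq> 0\<^sub>v n"
  shows "\<not> Q0_matrix (- M)"
proof
  assume Q0: "Q0_matrix (- M)"
  obtain w where w: "\<And>k. k \<in> {..<n} \<Longrightarrow> 0 < w k" "\<And>k. k \<in> {..<n} \<Longrightarrow> app w k < 0"
    using perron by blast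
  \<comment> \<open>One below the value that the last row takes at \<open>w\<close>, the vector to
    which \<open>u\<close> will turn out to be equal.\<close>
  let ?r = "(\<Sum>l<n. c $ l * w l) - 1"
  obtain u t where u: "\<And>k. k < n \<Longrightarrow> app u k + b $ k * t \<le> app w k"
    "\<And>k. k < n \<Longrightarrow> 0 < u k \<Longrightarrow> app u k + b $ k * t = app w k"
    and r: "(\<Sum>l<n. c $ l * u l) \<le> ?r"
    by (rule Q0_solution[OF Q0 assms(2), of "app w" ?r]) blast
  \<comment> \<open>The factor \<open>1\<close> gives the difference the shape of
    \<open>app_diff\<close>. Here \<open>u\<close> dominates \<open>w\<close>, so it is positive and
    complementarity turns every upper row into an equation.\<close>
  have "w k - 1 * u k \<le> 0" if "k < n" for k
  proof (rule inverse_nonpos[of "\<lambda>k. w k - 1 * u k"])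
    show "0 \<le> app (\<lambda>k. w k - 1 * u k) i" if "i \<in> {..<n}" for i
      using u(1)[of i] that assms(1) unfolding app_diff by simp
  qed (use that in simp)
  then have "0 < u k" if "k < n" for k
    using w(1)[of k] that by force
  then have "app (\<lambda>k. w k - 1 * u k) k = 0" if "k < n" for k
    using u(2)[OF that] that assms(1) unfolding app_diff by simp
  then have "w k - 1 * u k = 0" if "k < n" for k
    using A_kernel[of "\<lambda>k. w k - 1 * u k"] that by blast
  then have "(\<Sum>l<n. c $ l * u l) = (\<Sum>l<n. c $ l * w l)"
    by (intro sum.cong) auto
  then show False
    using r by simp
qed

text \<open>The null vector \<open>(d, - 1)\<close> of \<open>M\<close> vanishes where \<open>c\<close> does not, and it dominates a
  multiple of a column of \<open>- A\<^sup>-\<^sup>1\<close>; hence that inverse has a zero entry, and therefore a zero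
  diagonal entry. A positive last entry of the right-hand side forces \<open>t = 0\<close>.\<close>

lemma not_Q0_matrix_border_nonzero:
  assumes "b \<noteq> 0\<^sub>v n" "c \<noteq> 0\<^sub>v n"
  shows "\<not> Q0_matrix (- M)"
proof
  assume Q0: "Q0_matrix (- M)"
  obtain d where d: "\<And>k. k < n \<Longrightarrow> app d k = b $ k" "\<And>k. k < n \<Longrightarrow> 0 \<le> d k"
    "\<And>k. k < n \<Longrightarrow> c $ k * d k = 0"
    using null_vector by blast
  obtain i where i: "i < n" "c $ i \<noteq> 0"
    using c(1) assms(2) by (metis carrier_vecD eq_vecI index_zero_vec)
  obtain j where j: "j < n" "b $ j \<noteq> 0"
    using b(1) assms(1) by (metis carrier_vecD eq_vecI index_zero_vec)
  have bj: "b $ j < 0"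
    using j b_nonpos[of j] by simp
  obtain g where g: "\<And>k. k < n \<Longrightarrow> app g k = (if k = j then - 1 else 0)"
    using A_column by blast
  have g': "\<And>k. k \<in> {..<n} \<Longrightarrow> app g k = (if k = j then - 1 else 0)"
    using g by simp
  \<comment> \<open>The image of this vector is \<open>0\<close> at \<open>j\<close> and
    \<open>- b $ k\<close> at every other \<open>k\<close>, hence nonnegative.\<close>
  have "(\<lambda>k. (- (b $ j)) * g k - 1 * d k) i \<le> 0"
  proof (rule inverse_nonpos)
    show "0 \<le> app (\<lambda>k. (- (b $ j)) * g k - 1 * d k) k" if "k \<in> {..<n}" for k
      using that b_nonpos[of k] d(1)[of k] g[of k] unfolding app_diff app_scale by simp
  qed (use i in simp)
  moreover have "d i = 0"
    using d(3)[OF i(1)] i(2) by simp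
  ultimately have "(- (b $ j)) * g i \<le> 0"
    by simp
  then have "g i = 0"
    using bj column_nonneg[OF g', of i] i(1) mult_neg_pos[of "b $ j" "g i"] by force
  then have "g j = 0"
    using column_zero_imp_diagonal_zero[OF g', of i] i(1) j(1) by simp
  then obtain p where p: "\<nexists>u. \<forall>k\<in>{..<n}. 0 \<le> u k \<and> app u k \<le> p k \<and> (0 < u k \<longrightarrow> app u k = p k)"
    using unsolvable_if_diagonal_zero[OF g'] j(1) by blast
  obtain u t where u: "\<And>k. k < n \<Longrightarrow> 0 \<le> u k" "0 \<le> t"
    "\<And>k. k < n \<Longrightarrow> app u k + b $ k * t \<le> p k"
    "\<And>k. k < n \<Longrightarrow> 0 < u k \<Longrightarrow> app u k + b $ k * t = p k"
    and t: "0 < t \<Longrightarrow> (\<Sum>l<n. c $ l * u l) = 1"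
    by (rule Q0_solution[OF Q0 assms(2), of p 1]) blast
  have "t = 0"
    using t border_nonpos[of u] u(1,2) by force
  then have "\<forall>k\<in>{..<n}. 0 \<le> u k \<and> app u k \<le> p k \<and> (0 < u k \<longrightarrow> app u k = p k)"
    using u(1,3,4) by simp
  then show False
    using p by blast
qed

end

theorem theorem4p13:
  fixes n :: nat and A M :: "real mat" and b c :: "real vec"
  assumes "A \<in> carrier_mat n n"
    and "N0_matrix A"
    and "b \<in> carrier_vec n" and "b \<le> 0\<^sub>v n"
    and "c \<in> carrier_vec n" and "c \<le> 0\<^sub>v n"
    and "M = four_block_mat A (mat_of_cols n [b]) (mat_of_rows n [c]) (0\<^sub>m 1 1)"
    and "F0_matrix M"
    and "det M = 0"
  shows "(R0_matrix M \<longleftrightarrow> b \<noteq> 0\<^sub>v n) \<and>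
    \<not> semimonotone M \<and>
    (Q0_matrix (- M) \<longrightarrow> c = 0\<^sub>v n)"
proof -
  have "dim_row M = Suc n"
    using assms(1,7) by simp
  then have "2 \<le> n"
    using assms(8) by (simp add: F0_matrix_def)
  then interpret bordered_N0 n A M b c
    using assms by unfold_locales
  show ?thesis
    using R0_matrix_iff not_semimonotone_M not_Q0_matrix_border_zero
      not_Q0_matrix_border_nonzero by blast
qed

end
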